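(* For all integers $1 \le t \le r$ we have \[ R(r,t) \ge \left\lfloor \frac{r-t}{2} \right\rfloor + 1. \]
   Context: All hypergraphs are finite. An $r$-uniform hypergraph $\mathcal H$ is $r$-partite if its vertex set can be partitioned as $V(\mathcal H)=P_1\sqcup\dots\sqcup P_r$ such that $|e\cap P_j|=1$ for every edge $e$ and every $j\in[r]$. It is $t$-intersecting if $|e\cap f|\ge t$ for all $e,f\in E(\mathcal H)$. An $(r,t)$-graph is an $r$-uniform, $r$-partite, $t$-intersecting hypergraph. A cover of $\mathcal H$ is a set $C\subseteq V(\mathcal H)$ with $C\cap e\neq\emptyset$ for every edge $e$; the cover number $\tau(\mathcal H)$ is the minimum size of a cover. $R(r,t)$ denotes the maximum of $\tau(\mathcal H)$ over all $(r,t)$-graphs $\mathcal H$. *)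

theory Defs
  imports "HOL-Library.Disjoint_Sets"
begin

text \<open>A hypergraph is given by its vertex set \<open>V\<close> and its set \<open>E\<close> of edges.\<close>

definition hypergraph :: "'a set \<Rightarrow> 'a set set \<Rightarrow> bool" where
  "hypergraph V E \<longleftrightarrow> finite V \<and> (\<forall>e\<in>E. e \<subseteq> V)"

definition uniform :: "nat \<Rightarrow> 'a set set \<Rightarrow> bool" where
  "uniform r E \<longleftrightarrow> (\<forall>e\<in>E. card e = r)"

text \<open>The parts are indexed; a part may be empty (which can only happen if there are no edges).\<close>

definition partite :: "nat \<Rightarrow> 'a set \<Rightarrow> 'a set set \<Rightarrow> bool" where
  "partite r V E \<longleftrightarrow>
     (\<exists>P :: nat \<Rightarrow> 'a set. (\<Union>j\<in>{1..r}. P j) = V \<and> disjoint_family_on P {1..r} \<and>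
        (\<forall>e\<in>E. \<forall>j\<in>{1..r}. card (e \<inter> P j) = 1))"

text \<open>The edges \<open>e\<close> and \<open>f\<close> need not be distinct.\<close>

definition intersecting :: "nat \<Rightarrow> 'a set set \<Rightarrow> bool" where
  "intersecting t E \<longleftrightarrow> (\<forall>e\<in>E. \<forall>f\<in>E. t \<le> card (e \<inter> f))"

definition rt_graph :: "nat \<Rightarrow> nat \<Rightarrow> 'a set \<Rightarrow> 'a set set \<Rightarrow> bool" where
  "rt_graph r t V E \<longleftrightarrow>
     hypergraph V E \<and> uniform r E \<and> partite r V E \<and> intersecting t E"

definition cover :: "'a set \<Rightarrow> 'a set set \<Rightarrow> 'a set \<Rightarrow> bool" where
  "cover V E C \<longleftrightarrow> C \<subseteq> V \<and> (\<forall>e\<in>E. C \<inter> e \<noteq> {})"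

definition cover_number :: "'a set \<Rightarrow> 'a set set \<Rightarrow> nat" where
  "cover_number V E = (LEAST k. \<exists>C. cover V E C \<and> card C = k)"

text \<open>
  The maximum is taken over hypergraphs whose vertices are natural numbers; every finite
  hypergraph is isomorphic to one of these, see \<open>cover_number_le_R\<close> below. For \<open>t \<ge> 1\<close> the set
  is finite and nonempty, so that \<^const>\<open>Max\<close> is a genuine maximum
  (\<open>finite_cover_numbers\<close>, \<open>R_attained\<close>).
\<close>

definition R :: "nat \<Rightarrow> nat \<Rightarrow> nat" where
  "R r t = Max {cover_number V E | (V :: nat set) E. rt_graph r t V E}"

lemma cover_number_le: "cover V E C \<Longrightarrow> cover_number V E \<le> card C"
  unfolding cover_number_def by (rule Least_le) blast

lemma cover_number_le_rank:
  assumes "rt_graph r t V E" "1 \<le> t"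
  shows "cover_number V E \<le> r"
proof (cases "E = {}")
  case True
  then show ?thesis using cover_number_le[of V E "{}"] by (simp add: cover_def)
next
  case False
  then obtain e where e: "e \<in> E" by blast
  have "e \<inter> f \<noteq> {}" if "f \<in> E" for f
  proof
    assume "e \<inter> f = {}"
    moreover have "t \<le> card (e \<inter> f)"
      using assms(1) e that unfolding rt_graph_def intersecting_def by blast
    ultimately show False using assms(2) by simp
  qed
  then have "cover V E e"
    using assms(1) e unfolding rt_graph_def hypergraph_def cover_def by blast
  moreover have "card e = r" using assms(1) e unfolding rt_graph_def uniform_def by blast
  ultimately show ?thesis using cover_number_le by blast
qed

lemma finite_cover_numbers:
  assumes "1 \<le> t"
  shows "finite {cover_number V E | (V :: nat set) E. rt_graph r t V E}"
  by (rule finite_subset[of _ "{..r}"]) (use cover_number_le_rank assms in auto)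

lemma R_attained:
  assumes "1 \<le> t"
  shows "\<exists>(V :: nat set) E. rt_graph r t V E \<and> cover_number V E = R r t"
proof -
  have "rt_graph r t ({} :: nat set) {}"
    unfolding rt_graph_def hypergraph_def uniform_def partite_def intersecting_def
    by (auto intro!: exI[of _ "\<lambda>_. {}"] simp: disjoint_family_on_def)
  then have "R r t \<in> {cover_number V E | (V :: nat set) E. rt_graph r t V E}"
    unfolding R_def using finite_cover_numbers[OF assms] by (intro Max_in) blast+
  then show ?thesis by force
qed

lemma cover_number_le_R:
  fixes V :: "'a set"
  assumes g: "rt_graph r t V E" and t: "1 \<le> t"
  shows "cover_number V E \<le> R r t"
proof -
  have fin: "finite V" and sub: "\<And>e. e \<in> E \<Longrightarrow> e \<subseteq> V"
    using g unfolding rt_graph_def hypergraph_def by auto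
  obtain h :: "'a \<Rightarrow> nat" where inj: "inj_on h V"
    using finite_imp_inj_to_nat_seg[OF fin] by blast
  define E' where "E' = (`) h ` E"
  have ci: "card (h ` A) = card A" if "A \<subseteq> V" for A
    using inj that by (meson card_image inj_on_subset)
  have ii: "h ` A \<inter> h ` B = h ` (A \<inter> B)" if "A \<subseteq> V" "B \<subseteq> V" for A B
    using inj_on_image_Int[OF inj that] by simp
  obtain P :: "nat \<Rightarrow> 'a set" where P: "(\<Union>j\<in>{1..r}. P j) = V" "disjoint_family_on P {1..r}"
    "\<And>e j. e \<in> E \<Longrightarrow> j \<in> {1..r} \<Longrightarrow> card (e \<inter> P j) = 1"
    using g unfolding rt_graph_def partite_def by metis
  have PV: "P j \<subseteq> V" if "j \<in> {1..r}" for j using P(1) that by blast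
  have "hypergraph (h ` V) E'"
    using fin sub unfolding hypergraph_def E'_def by blast
  moreover have "uniform r E'"
    using g sub ci unfolding rt_graph_def uniform_def E'_def by auto
  moreover have "intersecting t E'"
    unfolding intersecting_def E'_def
  proof clarify
    fix e f assume "e \<in> E" "f \<in> E"
    then have "h ` e \<inter> h ` f = h ` (e \<inter> f)" "card (h ` (e \<inter> f)) = card (e \<inter> f)"
      "t \<le> card (e \<inter> f)"
      using g sub ii[of e f] ci[of "e \<inter> f"] unfolding rt_graph_def intersecting_def by blast+
    then show "t \<le> card (h ` e \<inter> h ` f)" by simp
  qed
  moreover have "partite r (h ` V) E'"
    unfolding partite_def
  proof (intro exI conjI)
    show "(\<Union>j\<in>{1..r}. h ` P j) = h ` V" using P(1) by blast
    show "disjoint_family_on (\<lambda>j. h ` P j) {1..r}"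
      unfolding disjoint_family_on_def
    proof (intro ballI impI)
      fix i j assume "i \<in> {1..r}" "j \<in> {1..r}" "i \<noteq> j"
      then show "h ` P i \<inter> h ` P j = {}"
        using ii[OF PV PV] P(2) unfolding disjoint_family_on_def by simp
    qed
    show "\<forall>e\<in>E'. \<forall>j\<in>{1..r}. card (e \<inter> h ` P j) = 1"
      unfolding E'_def
    proof (intro ballI)
      fix e' j assume "e' \<in> (`) h ` E" and j: "j \<in> {1..r}"
      then obtain e where e: "e \<in> E" "e' = h ` e" by blast
      have "e' \<inter> h ` P j = h ` (e \<inter> P j)" using ii[OF sub PV] e j by simp
      moreover have "card (h ` (e \<inter> P j)) = card (e \<inter> P j)" using ci sub e by blast
      ultimately show "card (e' \<inter> h ` P j) = 1" using P(3) e j by simp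
    qed
  qed
  ultimately have g': "rt_graph r t (h ` V) E'" unfolding rt_graph_def by blast
  have "cover_number V E \<le> card C'" if C': "cover (h ` V) E' C'" for C'
  proof -
    from C' obtain C where C: "C \<subseteq> V" "C' = h ` C"
      unfolding cover_def by (meson subset_imageE)
    have "C \<inter> e \<noteq> {}" if "e \<in> E" for e
    proof -
      have "h ` C \<inter> h ` e \<noteq> {}" using C' C that unfolding cover_def E'_def by blast
      then show ?thesis using ii[OF C(1) sub[OF that]] by auto
    qed
    then have "cover V E C" using C unfolding cover_def by blast
    then show ?thesis using cover_number_le ci C by metis
  qed
  moreover have "\<exists>C. cover (h ` V) E' C \<and> card C = cover_number (h ` V) E'"
  proof -
    have "f \<noteq> {}" "f \<subseteq> h ` V" if "f \<in> E'" for f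
      using g' that t unfolding rt_graph_def intersecting_def hypergraph_def by force+
    then have "cover (h ` V) E' (h ` V)" unfolding cover_def by blast
    then have "\<exists>k. \<exists>C. cover (h ` V) E' C \<and> card C = k" by blast
    then show ?thesis unfolding cover_number_def by (rule LeastI_ex)
  qed
  ultimately have "cover_number V E \<le> cover_number (h ` V) E'" by metis
  also have "\<dots> \<le> R r t"
    unfolding R_def using finite_cover_numbers[OF t] g' by (intro Max_ge) blast+
  finally show ?thesis .
qed

end

theory Submission
  imports Defs
begin

text \<open>
  Let \<open>k = (r - t) div 2\<close> and take as edges the graphs of the functions \<open>{1..r} \<rightarrow> {0..k}\<close> of
  support at most \<open>k\<close>. Two of them both vanish, hence agree, in at least \<open>r - 2 * k \<ge> t\<close> places.
  A set \<open>C\<close> of \<open>k\<close> vertices is not a cover: it meets at most \<open>k\<close> columns in the value \<open>0\<close>, and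
  each column has \<open>k + 1\<close> values, so one can leave \<open>0\<close> in exactly those columns and avoid \<open>C\<close>.
\<close>

definition graph_on :: "'a set \<Rightarrow> ('a \<Rightarrow> 'b) \<Rightarrow> ('a \<times> 'b) set" where
  "graph_on A f = (\<lambda>j. (j, f j)) ` A"

definition sparse_vertices :: "nat \<Rightarrow> nat \<Rightarrow> (nat \<times> nat) set" where
  "sparse_vertices r k = {1..r} \<times> {0..k}"

text \<open>The Hamming ball of radius \<open>k\<close> around the zero word in
  \<open>{0..k}\<close> to the power \<open>r\<close>, each word encoded as its set of (position,
  letter) pairs.\<close>

definition sparse_edges :: "nat \<Rightarrow> nat \<Rightarrow> (nat \<times> nat) set set" where
  "sparse_edges r k =
     {graph_on {1..r} f | f. f ` {1..r} \<subseteq> {0..k} \<and> card {j \<in> {1..r}. f j \<noteq> 0} \<le> k}"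

lemma sparse_edgesE:
  assumes "e \<in> sparse_edges r k"
  obtains f where "e = graph_on {1..r} f" "f ` {1..r} \<subseteq> {0..k}"
    "card {j \<in> {1..r}. f j \<noteq> 0} \<le> k"
  using assms unfolding sparse_edges_def by blast

lemma card_graph_on: "card (graph_on A f) = card A"
  unfolding graph_on_def by (rule card_image) (simp add: inj_on_def)

lemma graph_on_Int: "graph_on A f \<inter> graph_on A g = graph_on {j \<in> A. f j = g j} f"
  unfolding graph_on_def by auto

lemma graph_on_Int_Times:
  assumes "j \<in> A" "f j \<in> B"
  shows "graph_on A f \<inter> ({j} \<times> B) = {(j, f j)}"
  using assms unfolding graph_on_def by auto

text \<open>Both functions vanish outside the union of their supports, and that union has at most
  \<open>2 * k\<close> elements.\<close>

lemma card_agree_ge: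
  fixes f g :: "'a \<Rightarrow> 'b::zero"
  assumes "finite A" "card {j \<in> A. f j \<noteq> 0} \<le> k" "card {j \<in> A. g j \<noteq> 0} \<le> k"
  shows "card A - 2 * k \<le> card {j \<in> A. f j = g j}"
proof -
  let ?F = "{j \<in> A. f j \<noteq> 0}" and ?G = "{j \<in> A. g j \<noteq> 0}"
  have "card A - card (?F \<union> ?G) \<le> card (A - (?F \<union> ?G))"
    using assms(1) by (intro diff_card_le_card_Diff) auto
  moreover have "card (?F \<union> ?G) \<le> card ?F + card ?G" by (rule card_Un_le)
  moreover have "card (A - (?F \<union> ?G)) \<le> card {j \<in> A. f j = g j}"
    using assms(1) by (intro card_mono) auto
  ultimately show ?thesis using assms by linarith
qed

lemma rt_graph_sparse:
  assumes "t + 2 * k \<le> r"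
  shows "rt_graph r t (sparse_vertices r k) (sparse_edges r k)"
proof -
  have "hypergraph (sparse_vertices r k) (sparse_edges r k)"
    unfolding hypergraph_def sparse_vertices_def
    by (auto elim!: sparse_edgesE simp: graph_on_def image_subset_iff)
  moreover have "uniform r (sparse_edges r k)"
    unfolding uniform_def by (auto elim!: sparse_edgesE simp: card_graph_on)
  moreover have "partite r (sparse_vertices r k) (sparse_edges r k)"
    unfolding partite_def
  proof (intro exI conjI ballI)
    \<comment> \<open>The parts are the columns; the graph of a function meets each column exactly
      once.\<close>
    show "(\<Union>j\<in>{1..r}. {j} \<times> {0..k}) = sparse_vertices r k"
      unfolding sparse_vertices_def by auto
    show "disjoint_family_on (\<lambda>j. {j} \<times> {0..k}) {1..r}"
      unfolding disjoint_family_on_def by auto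
    fix e j assume "e \<in> sparse_edges r k" and j: "j \<in> {1..r}"
    then obtain f where f: "e = graph_on {1..r} f" "f ` {1..r} \<subseteq> {0..k}"
      by (blast elim: sparse_edgesE)
    then have "f j \<in> {0..k}" using j by blast
    then have "e \<inter> ({j} \<times> {0..k}) = {(j, f j)}"
      unfolding f(1) by (rule graph_on_Int_Times[OF j])
    then show "card (e \<inter> ({j} \<times> {0..k})) = 1" by simp
  qed
  moreover have "intersecting t (sparse_edges r k)"
    unfolding intersecting_def
  proof (intro ballI)
    fix e e' assume "e \<in> sparse_edges r k" "e' \<in> sparse_edges r k"
    then obtain f g where "e = graph_on {1..r} f" "e' = graph_on {1..r} g"
      "card {j \<in> {1..r}. f j \<noteq> 0} \<le> k" "card {j \<in> {1..r}. g j \<noteq> 0} \<le> k"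
      by (elim sparse_edgesE) blast
    then have "r - 2 * k \<le> card (e \<inter> e')"
      using card_agree_ge[of "{1..r}" f k g] by (simp add: graph_on_Int card_graph_on)
    then show "t \<le> card (e \<inter> e')" using assms by linarith
  qed
  ultimately show ?thesis unfolding rt_graph_def by blast
qed

lemma card_cover_sparse:
  assumes C: "cover (sparse_vertices r k) (sparse_edges r k) C"
  shows "k < card C"
proof (rule ccontr)
  assume "\<not> k < card C"
  then have Ck: "card C \<le> k" by simp
  have fin: "finite C"
    using C unfolding cover_def sparse_vertices_def
    by (meson finite_SigmaI finite_atLeastAtMost finite_subset)
  \<comment> \<open>A column contained in \<open>C\<close> would put \<open>k + 1\<close> elements
    into \<open>C\<close>.\<close>
  have "\<exists>v\<in>{0..k}. (j, v) \<notin> C" for j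
  proof (rule ccontr)
    assume "\<not> ?thesis"
    then have "Pair j ` {0..k} \<subseteq> C" by blast
    then have "card (Pair j ` {0..k}) \<le> card C" by (rule card_mono[OF fin])
    then show False using Ck by (simp add: card_image inj_on_def)
  qed
  then obtain v where v: "\<And>j. v j \<in> {0..k}" "\<And>j. (j, v j) \<notin> C" by metis
  \<comment> \<open>The value 0 is given up only where \<open>C\<close> forces it, so the support of
    \<open>f\<close> lies in the projection of \<open>C\<close> and has at most
    \<open>card C\<close> elements.\<close>
  define f where "f j = (if (j, 0) \<in> C then v j else 0)" for j
  have avoid: "(j, f j) \<notin> C" for j using v(2) by (simp add: f_def)
  have "{j \<in> {1..r}. f j \<noteq> 0} \<subseteq> fst ` C"
  proof
    fix j assume "j \<in> {j \<in> {1..r}. f j \<noteq> 0}"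
    then have "(j, 0) \<in> C" by (simp add: f_def split: if_splits)
    then show "j \<in> fst ` C" by (metis fst_conv image_eqI)
  qed
  then have "card {j \<in> {1..r}. f j \<noteq> 0} \<le> card (fst ` C)"
    using fin by (intro card_mono) auto
  also have "\<dots> \<le> k" using card_image_le[OF fin, of fst] Ck by linarith
  finally have "card {j \<in> {1..r}. f j \<noteq> 0} \<le> k" .
  moreover have "f ` {1..r} \<subseteq> {0..k}" using v(1) by (auto simp: f_def)
  ultimately have "graph_on {1..r} f \<in> sparse_edges r k"
    unfolding sparse_edges_def by blast
  then have "C \<inter> graph_on {1..r} f \<noteq> {}" using C unfolding cover_def by blast
  then show False using avoid unfolding graph_on_def by blast
qed

text \<open>The whole vertex set must be a cover, as \<^const>\<open>cover_number\<close> is an unspecified value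
  when some edge is empty.\<close>

lemma cover_number_attained:
  assumes "hypergraph V E" "{} \<notin> E"
  obtains C where "cover V E C" "card C = cover_number V E"
proof -
  have "cover V E V"
    using assms unfolding cover_def hypergraph_def by (metis Int_absorb1 subset_refl)
  then have "\<exists>k C. cover V E C \<and> card C = k" by blast
  then have "\<exists>C. cover V E C \<and> card C = cover_number V E"
    unfolding cover_number_def by (rule LeastI_ex)
  then show thesis using that by blast
qed

theorem theorem1p3:
  fixes r t :: nat
  assumes "1 \<le> t" and "t \<le> r"
  shows "R r t \<ge> (r - t) div 2 + 1"
proof -
  define k where "k = (r - t) div 2"
  \<comment> \<open>Since \<open>t \<le> r\<close>, this \<open>k\<close> is the largest number with
    \<open>t + 2 * k \<le> r\<close>.\<close>
  have g: "rt_graph r t (sparse_vertices r k) (sparse_edges r k)"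
    using assms by (intro rt_graph_sparse) (simp add: k_def)
  \<comment> \<open>Every edge is a graph over \<open>{1..r}\<close>, which is nonempty because
    \<open>1 \<le> t \<le> r\<close>.\<close>
  have "{} \<notin> sparse_edges r k"
    using assms by (auto elim!: sparse_edgesE simp: graph_on_def)
  then obtain C where "cover (sparse_vertices r k) (sparse_edges r k) C"
    "card C = cover_number (sparse_vertices r k) (sparse_edges r k)"
    using g unfolding rt_graph_def by (metis cover_number_attained)
  then have "k < cover_number (sparse_vertices r k) (sparse_edges r k)"
    using card_cover_sparse by metis
  \<comment> \<open>The vertices here are pairs, while \<open>R\<close> ranges over hypergraphs on
    the naturals; \<open>cover_number_le_R\<close> bridges this, as it holds for any vertex
    type.\<close>
  then show ?thesis using cover_number_le_R[OF g assms(1)] by (simp add: k_def)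
qed

end
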